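(* Let $\nu>-1/2$ and $0<\gamma<1$. For every $\theta\in(\gamma,1)$ and all $x>0$, $$\int_0^x e^{-\gamma t}\,\frac{I_\nu(t)}{t^\nu}\,dt<\max\left\{2(\nu+1)\exp\left(\frac{2\gamma(\nu+2)\theta}{1-\theta}\right),\ \frac{\nu+1+\theta}{(\nu+2)\theta(\theta-\gamma)}\right\}e^{-\gamma x}\,\frac{I_{\nu+1}(x)}{x^\nu}.$$ In particular, for every $\nu>-1/2$ and $0<\gamma<1$ there is a finite constant $M_{\nu,\gamma}$ such that $\int_0^x e^{-\gamma t}I_\nu(t)t^{-\nu}\,dt<M_{\nu,\gamma}\,e^{-\gamma x}I_{\nu+1}(x)x^{-\nu}$ for all $x>0$.
   Context: $I_\alpha(x)=\sum_{k=0}^{\infty}\frac{(x/2)^{2k+\alpha}}{k!\,\Gamma(k+\alpha+1)}$, $x>0$, is the modified Bessel function of the first kind. *)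

theory Defs
  imports "HOL-Analysis.Analysis"
begin

text \<open>The modified Bessel function of the first kind. It is only meaningful for \<open>x > 0\<close>:
  with \<open>powr\<close>, each term vanishes at \<open>x = 0\<close>, even for \<open>\<alpha> = 0\<close>, where the usual value is 1.\<close>

definition bessel_I :: "real \<Rightarrow> real \<Rightarrow> real" where
  "bessel_I \<alpha> x =
     (\<Sum>k. (x / 2) powr (2 * real k + \<alpha>) / (fact k * Gamma (real k + \<alpha> + 1)))"

end

theory Submission
  imports Defs
begin

text \<open>
  Write \<open>f(t) = I\<^sub>\<nu>(t)/t\<^sup>\<nu>\<close> and \<open>g(t) = I\<^bsub>\<nu>+1\<^esub>(t)/t\<^sup>\<nu>\<close>. Both are entire: if
  \<open>P\<^sub>a(z) = \<Sum>k. z\<^sup>k / (k! \<Gamma>(k+a+1))\<close>, then up to the common factor \<open>2\<^bsup>-\<nu>\<^esup>\<close> they are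
  \<open>P\<^sub>\<nu>(t\<^sup>2/4)\<close> and \<open>(t/2) P\<^bsub>\<nu>+1\<^esub>(t\<^sup>2/4)\<close>. Two facts about these series,
  \<open>P\<^sub>a' = P\<^bsub>a+1\<^esub>\<close> and \<open>P\<^sub>a(z) = (a+1) P\<^bsub>a+1\<^esub>(z) + z P\<^bsub>a+2\<^esub>(z)\<close>, give the
  logarithmic derivative of \<open>g\<close> and the quotient \<open>f/g\<close> in terms of the single ratio
  \<open>r = I\<^bsub>\<nu>+2\<^esub>/I\<^bsub>\<nu>+1\<^esub>\<close>: namely \<open>g' = (r + 1/t) g\<close> and \<open>f = (r + 2(\<nu>+1)/t) g\<close>.

  The threshold \<open>x\<^sub>0 = 2(\<nu>+2)\<theta>/(1-\<theta>)\<close> separates two regimes, one for each entry of the maximum.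

  For every \<open>x > 0\<close>, \<open>2(\<nu>+1) g' - f\<close> is a positive multiple of \<open>2\<nu>+1\<close>, so even without the
  weight \<open>e\<^bsup>-\<gamma>t\<^esup>\<close> the integral of \<open>f\<close> over \<open>[0,x]\<close> is less than \<open>2(\<nu>+1) g(x)\<close>
  (\<open>weighted_integral_less\<close>). For \<open>x \<le> x\<^sub>0\<close> the missing factor \<open>e\<^bsup>-\<gamma>x\<^esup>\<close> costs at most
  \<open>e\<^bsup>\<gamma> x\<^sub>0\<^esup>\<close>.

  For \<open>x > x\<^sub>0\<close> the integrand is compared with the derivative of \<open>M e\<^bsup>-\<gamma>t\<^esup> g(t)\<close>, which is
  \<open>M (r + 1/t - \<gamma>) e\<^bsup>-\<gamma>t\<^esup> g(t)\<close>. The bound \<open>r > t/(t + 2(\<nu>+2))\<close> holds because, by the recurrence,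
  it says \<open>I\<^bsub>\<nu>+3\<^esub> < I\<^bsub>\<nu>+2\<^esub>\<close> (\<open>bessel_series_shift_less\<close>), and its right-hand
  side is at least \<open>\<theta>\<close> exactly when \<open>t \<ge> x\<^sub>0\<close>. What is left is an inequality between rational functions
  (\<open>tail_constant_bound\<close>), which the second entry of the maximum satisfies.
\<close>

section \<open>The entire series behind the modified Bessel functions\<close>

definition bessel_coeff :: "real \<Rightarrow> nat \<Rightarrow> real" where
  "bessel_coeff a k = 1 / (fact k * Gamma (real k + a + 1))"

definition bessel_series :: "real \<Rightarrow> real \<Rightarrow> real" where
  "bessel_series a z = (\<Sum>k. bessel_coeff a k * z ^ k)"

lemma bessel_coeff_pos: "a > -1 \<Longrightarrow> bessel_coeff a k > 0"
  unfolding bessel_coeff_def by (simp add: Gamma_real_pos)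

lemma bessel_coeff_shift:
  assumes "a > -1"
  shows "(real k + a + 1) * bessel_coeff (a + 1) k = bessel_coeff a k"
proof -
  have "Gamma (real k + (a + 1) + 1) = (real k + a + 1) * Gamma (real k + a + 1)"
    using Gamma_plus1[of "real k + a + 1"] assms nonpos_Ints_nonpos[of "real k + a + 1"]
    by (force simp: algebra_simps)
  then show ?thesis using assms unfolding bessel_coeff_def by simp
qed

lemma bessel_coeff_Suc: "real (Suc k) * bessel_coeff a (Suc k) = bessel_coeff (a + 1) k"
proof -
  have e: "real (Suc k) + a + 1 = real k + (a + 1) + 1" by simp
  show ?thesis unfolding bessel_coeff_def e by (simp del: of_nat_Suc)
qed

lemma summable_bessel_coeff:
  assumes "a > -1"
  shows "summable (\<lambda>k. bessel_coeff a k * z ^ k)"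
proof (rule summable_ratio_test[of "1/2" "nat \<lceil>2 * \<bar>z\<bar> + 1\<rceil>"])
  fix k assume "nat \<lceil>2 * \<bar>z\<bar> + 1\<rceil> \<le> k"
  then have k: "real k \<ge> 2 * \<bar>z\<bar> + 1" by linarith
  have "2 * \<bar>z\<bar> \<le> real (Suc k) * 1" using k by simp
  also have "\<dots> \<le> real (Suc k) * (real k + a + 1)"
    using k assms by (intro mult_left_mono) auto
  finally have q: "2 * \<bar>z\<bar> \<le> real (Suc k) * (real k + a + 1)" .
  have c: "bessel_coeff a k = (real k + a + 1) * (real (Suc k) * bessel_coeff a (Suc k))"
    using bessel_coeff_shift[OF assms, of k] bessel_coeff_Suc[of k a] by simp
  have "bessel_coeff a (Suc k) * (2 * \<bar>z\<bar>) \<le> bessel_coeff a k"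
    using mult_left_mono[OF q, of "bessel_coeff a (Suc k)"] bessel_coeff_pos[OF assms, of "Suc k"]
    unfolding c by (simp add: mult_ac)
  then have "bessel_coeff a (Suc k) * (2 * \<bar>z\<bar>) * \<bar>z\<bar> ^ k \<le> bessel_coeff a k * \<bar>z\<bar> ^ k"
    by (intro mult_right_mono) auto
  then show "norm (bessel_coeff a (Suc k) * z ^ Suc k) \<le> 1 / 2 * norm (bessel_coeff a k * z ^ k)"
    using bessel_coeff_pos[OF assms, of k] bessel_coeff_pos[OF assms, of "Suc k"]
    by (simp add: abs_mult power_abs mult_ac)
qed simp

lemma bessel_series_pos:
  assumes "a > -1" "z \<ge> 0"
  shows "bessel_series a z > 0"
  unfolding bessel_series_def
  using bessel_coeff_pos[OF assms(1)] assms(2)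
  by (intro suminf_pos2[OF summable_bessel_coeff[OF assms(1)], where i = 0])
     (auto simp: less_imp_le)

lemma DERIV_bessel_series:
  assumes "a > -1"
  shows "(bessel_series a has_real_derivative bessel_series (a + 1) z) (at z)"
proof -
  have d: "diffs (bessel_coeff a) = bessel_coeff (a + 1)"
    unfolding diffs_def using bessel_coeff_Suc by auto
  have s: "summable (\<lambda>k. bessel_coeff a k * y ^ k)" for y
    by (rule summable_bessel_coeff[OF assms])
  have "((\<lambda>z. \<Sum>k. bessel_coeff a k * z ^ k) has_real_derivative
          (\<Sum>k. diffs (bessel_coeff a) k * z ^ k)) (at z)"
    by (rule termdiffs_strong_converges_everywhere[OF s])
  moreover have "(\<lambda>z. \<Sum>k. bessel_coeff a k * z ^ k) = bessel_series a"
    by (simp add: bessel_series_def fun_eq_iff)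
  ultimately show ?thesis
    unfolding d by (simp add: bessel_series_def)
qed

text \<open>This is the three-term recurrence \<open>I\<^sub>a(x) = (2(a+1)/x) I\<^bsub>a+1\<^esub>(x) + I\<^bsub>a+2\<^esub>(x)\<close>. In
  coefficients it is the splitting \<open>k + a + 1 = (a + 1) + k\<close>, where the factor \<open>k\<close> shifts the index.\<close>

lemma bessel_series_recurrence:
  assumes "a > -1"
  shows "bessel_series a z = (a + 1) * bessel_series (a + 1) z + z * bessel_series (a + 2) z"
proof -
  let ?t = "\<lambda>k. real k * bessel_coeff (a + 1) k * z ^ k"
  have s0: "summable (\<lambda>k. bessel_coeff a k * z ^ k)"
    and s1: "summable (\<lambda>k. bessel_coeff (a + 1) k * z ^ k)"
    and s2: "summable (\<lambda>k. bessel_coeff (a + 2) k * z ^ k)"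
    using assms by (intro summable_bessel_coeff; simp)+
  have t: "?t k = bessel_coeff a k * z ^ k - (a + 1) * (bessel_coeff (a + 1) k * z ^ k)" for k
    unfolding bessel_coeff_shift[OF assms, of k, symmetric] by (simp add: algebra_simps)
  have st: "summable ?t"
    unfolding t by (intro summable_diff s0 summable_mult s1)
  have "bessel_series a z - (a + 1) * bessel_series (a + 1) z = suminf ?t"
    unfolding t bessel_series_def
    by (simp add: suminf_diff[symmetric] suminf_mult s0 s1 summable_mult)
  also have "\<dots> = (\<Sum>k. ?t (Suc k))"
    using suminf_split_head[OF st] by simp
  also have "\<dots> = (\<Sum>k. z * (bessel_coeff (a + 2) k * z ^ k))"
    using bessel_coeff_Suc[of _ "a + 1"] by (intro suminf_cong) (simp add: mult_ac add_ac)
  also have "\<dots> = z * bessel_series (a + 2) z"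
    unfolding bessel_series_def by (rule suminf_mult[OF s2])
  finally show ?thesis by simp
qed

text \<open>This is \<open>I\<^bsub>a+1\<^esub> < I\<^sub>a\<close> for \<open>a \<ge> 0\<close>, with \<open>y = x/2\<close>. The coefficient of the odd power
  \<open>y\<^bsup>2k+1\<^esup>\<close> on the left is at most the geometric mean of the coefficients of the neighbouring even
  powers on the right, so by the arithmetic-geometric mean inequality each odd term is at most the
  average of the two neighbouring even terms. Summing uses every even term fully, except the
  constant one, of which only half is used; this makes the inequality strict.\<close>

lemma bessel_series_shift_less:
  assumes "a \<ge> 0" "y \<ge> 0"
  shows "y * bessel_series (a + 1) (y\<^sup>2) < bessel_series a (y\<^sup>2)"
proof -
  have a: "a > -1" "a + 1 > -1" using assms by auto
  let ?e = "\<lambda>k. bessel_coeff a k * (y\<^sup>2) ^ k"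
  let ?d = "\<lambda>k. bessel_coeff (a + 1) k * (y\<^sup>2) ^ k"
  have se: "summable ?e" and sd: "summable ?d"
    using a by (intro summable_bessel_coeff; simp)+
  have seS: "summable (\<lambda>k. ?e (Suc k))" using se by (rule summable_Suc_iff[THEN iffD2])
  have avg: "2 * (y * ?d k) \<le> ?e k + ?e (Suc k)" for k
  proof -
    define d c where "d = bessel_coeff (a + 1) k" and "c = real k + a + 1"
    have dpos: "d > 0" and c: "c > 0" "real k + 1 \<le> c"
      using bessel_coeff_pos[OF a(2), of k] assms by (auto simp: d_def c_def)
    have e0: "bessel_coeff a k = c * d"
      using bessel_coeff_shift[OF a(1), of k] by (simp add: c_def d_def)
    have "d = (real k + 1) * bessel_coeff a (Suc k)"
      using bessel_coeff_Suc[of k a] by (simp add: d_def algebra_simps)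
    also have "\<dots> \<le> c * bessel_coeff a (Suc k)"
      using c bessel_coeff_pos[OF a(1), of "Suc k"] by (intro mult_right_mono) auto
    finally have e1: "d / c \<le> bessel_coeff a (Suc k)"
      using c by (simp add: field_simps)
    \<comment> \<open>The weight \<open>c\<close> makes the first term \<open>c d\<close> exactly the coefficient of \<open>y\<^bsup>2k\<^esup>\<close>.\<close>
    have "0 \<le> d / c * (c - y)\<^sup>2"
      using dpos c by (intro mult_nonneg_nonneg) auto
    also have "\<dots> = c * d - 2 * y * d + d / c * y\<^sup>2"
      using c by (simp add: power2_eq_square field_simps)
    also have "\<dots> \<le> c * d - 2 * y * d + bessel_coeff a (Suc k) * y\<^sup>2"
      using mult_right_mono[OF e1, of "y\<^sup>2"] by simp
    finally have "(2 * y * d) * (y\<^sup>2) ^ k \<le> (c * d + bessel_coeff a (Suc k) * y\<^sup>2) * (y\<^sup>2) ^ k"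
      by (intro mult_right_mono) auto
    then show ?thesis unfolding e0 d_def[symmetric] by (simp add: algebra_simps)
  qed
  have "2 * (y * bessel_series (a + 1) (y\<^sup>2)) = (\<Sum>k. 2 * (y * ?d k))"
    unfolding bessel_series_def by (simp add: suminf_mult sd summable_mult)
  also have "\<dots> \<le> (\<Sum>k. ?e k + ?e (Suc k))"
    by (rule suminf_le[OF avg]) (intro summable_mult sd summable_add se seS)+
  also have "\<dots> = suminf ?e + (\<Sum>k. ?e (Suc k))"
    by (rule suminf_add[OF se seS, symmetric])
  also have "\<dots> = 2 * bessel_series a (y\<^sup>2) - bessel_coeff a 0"
    using suminf_split_head[OF se] unfolding bessel_series_def by simp
  finally show ?thesis using bessel_coeff_pos[OF a(1), of 0] by simp
qed

lemma bessel_I_eq_bessel_series: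
  assumes "a > -1" "x > 0"
  shows "bessel_I a x = (x / 2) powr a * bessel_series a ((x / 2)\<^sup>2)"
proof -
  have "(x / 2) powr (2 * real k + a) / (fact k * Gamma (real k + a + 1))
        = (x / 2) powr a * (bessel_coeff a k * ((x / 2)\<^sup>2) ^ k)" for k
  proof -
    have "(x / 2) powr (2 * real k) = ((x / 2)\<^sup>2) ^ k"
      using powr_realpow[of "x / 2" "2 * k"] assms(2) by (simp add: power_mult)
    then show ?thesis by (simp add: powr_add bessel_coeff_def)
  qed
  then show ?thesis
    unfolding bessel_I_def bessel_series_def
    by (simp add: suminf_mult[OF summable_bessel_coeff[OF assms(1)]])
qed

section \<open>Comparing an integral with an antiderivative\<close>

lemma integral_less_increment:
  fixes \<phi> G G' :: "real \<Rightarrow> real"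
  assumes "a < b" and cont: "continuous_on {a..b} \<phi>"
    and G: "\<And>t. (G has_real_derivative G' t) (at t)"
    and less: "\<And>t. a < t \<Longrightarrow> t < b \<Longrightarrow> \<phi> t < G' t"
  shows "integral {a..b} \<phi> < G b - G a"
proof -
  let ?K = "\<lambda>x. G x - integral {a..x} \<phi>"
  have D: "(?K has_real_derivative G' t - \<phi> t) (at t within {a..b})" if "t \<in> {a..b}" for t
    using G[of t] integral_has_real_derivative[OF cont that]
    by (intro DERIV_diff) (auto intro: has_field_derivative_at_within)
  have "?K a < ?K b"
  proof (rule DERIV_pos_imp_increasing_open[OF \<open>a < b\<close>])
    fix t assume t: "a < t" "t < b"
    then show "\<exists>y. (?K has_real_derivative y) (at t) \<and> 0 < y"
      using D[of t] less[of t] at_within_Icc_at[of a t b] by auto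
  next
    show "continuous_on {a..b} ?K"
      using D by (meson DERIV_continuous continuous_on_eq_continuous_within)
  qed
  then show ?thesis by simp
qed

section \<open>The two sides of the inequality as entire functions\<close>

definition bessel_f :: "real \<Rightarrow> real \<Rightarrow> real" where
  "bessel_f \<nu> t = 2 powr (-\<nu>) * bessel_series \<nu> ((t / 2)\<^sup>2)"

definition bessel_g :: "real \<Rightarrow> real \<Rightarrow> real" where
  "bessel_g \<nu> t = 2 powr (-\<nu>) * (t / 2 * bessel_series (\<nu> + 1) ((t / 2)\<^sup>2))"

definition bessel_g_deriv :: "real \<Rightarrow> real \<Rightarrow> real" where
  "bessel_g_deriv \<nu> t = 2 powr (-\<nu>) *
     (bessel_series (\<nu> + 1) ((t / 2)\<^sup>2) / 2 + (t / 2)\<^sup>2 * bessel_series (\<nu> + 2) ((t / 2)\<^sup>2))"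

lemma bessel_I_div_powr:
  assumes "\<nu> > -1" "t > 0"
  shows "bessel_I \<nu> t / t powr \<nu> = bessel_f \<nu> t"
  using assms
  by (simp add: bessel_I_eq_bessel_series bessel_f_def powr_divide powr_minus field_simps)

lemma bessel_I_Suc_div_powr:
  assumes "\<nu> > -1" "t > 0"
  shows "bessel_I (\<nu> + 1) t / t powr \<nu> = bessel_g \<nu> t"
  using assms
  by (simp add: bessel_I_eq_bessel_series bessel_g_def powr_divide powr_minus powr_add field_simps)

lemma continuous_on_bessel_f:
  assumes "\<nu> > -1"
  shows "continuous_on S (bessel_f \<nu>)"
proof -
  have "continuous_on UNIV (bessel_series \<nu>)"
    using DERIV_isCont[OF DERIV_bessel_series[OF assms]] continuous_at_imp_continuous_on by blast
  then have "continuous_on S (\<lambda>t. bessel_series \<nu> ((t / 2)\<^sup>2))"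
    by (rule continuous_on_compose2) (auto intro!: continuous_intros)
  then show ?thesis
    unfolding bessel_f_def[abs_def] by (rule continuous_on_mult_left)
qed

lemma DERIV_bessel_g:
  assumes "\<nu> > -1"
  shows "(bessel_g \<nu> has_real_derivative bessel_g_deriv \<nu> t) (at t)"
proof -
  have P: "(bessel_series (\<nu> + 1) has_real_derivative bessel_series (\<nu> + 2) z) (at z)" for z
    using DERIV_bessel_series[of "\<nu> + 1" z] assms by (simp add: add_ac)
  have sq: "((\<lambda>t. (t / 2)\<^sup>2) has_real_derivative t / 2) (at t)"
    by (auto intro!: derivative_eq_intros)
  have "((\<lambda>t. bessel_series (\<nu> + 1) ((t / 2)\<^sup>2)) has_real_derivative
          bessel_series (\<nu> + 2) ((t / 2)\<^sup>2) * (t / 2)) (at t)"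
    by (rule DERIV_chain2[where g = "\<lambda>t. (t / 2)\<^sup>2", OF P sq])
  then show ?thesis
    unfolding bessel_g_def[abs_def] bessel_g_deriv_def
    by (auto intro!: derivative_eq_intros simp: power2_eq_square algebra_simps)
qed

lemma bessel_g_pos: "\<nu> > -1 \<Longrightarrow> t > 0 \<Longrightarrow> bessel_g \<nu> t > 0"
  unfolding bessel_g_def by (simp add: bessel_series_pos)

text \<open>The number \<open>r\<close> is the ratio \<open>I\<^bsub>\<nu>+2\<^esub>(t)/I\<^bsub>\<nu>+1\<^esub>(t)\<close>. By the recurrence, its lower bound
  is the inequality \<open>I\<^bsub>\<nu>+3\<^esub> < I\<^bsub>\<nu>+2\<^esub>\<close>.\<close>

lemma bessel_ratio:
  assumes "\<nu> > -1" "t > 0"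
  obtains r where "r > t / (t + 2 * (\<nu> + 2))"
    and "bessel_f \<nu> t = (r + 2 * (\<nu> + 1) / t) * bessel_g \<nu> t"
    and "bessel_g_deriv \<nu> t = (r + 1 / t) * bessel_g \<nu> t"
proof -
  define y where "y = t / 2"
  define p q s where "p = bessel_series (\<nu> + 1) (y\<^sup>2)"
    and "q = bessel_series (\<nu> + 2) (y\<^sup>2)" and "s = bessel_series (\<nu> + 3) (y\<^sup>2)"
  have y: "y > 0" "t = 2 * y" using assms by (auto simp: y_def)
  have p: "p > 0" using assms by (auto simp: p_def intro!: bessel_series_pos)
  have f: "bessel_series \<nu> (y\<^sup>2) = (\<nu> + 1) * p + y\<^sup>2 * q"
    using bessel_series_recurrence[of \<nu> "y\<^sup>2"] assms by (simp add: p_def q_def)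
  have pq: "p = (\<nu> + 2) * q + y\<^sup>2 * s"
    using bessel_series_recurrence[of "\<nu> + 1" "y\<^sup>2"] assms by (simp add: p_def q_def s_def add_ac)
  have "y * s < q"
    using bessel_series_shift_less[of "\<nu> + 2" y] assms y by (simp add: q_def s_def add_ac)
  then have "y * (y * s) < y * q" using y by simp
  then have "p < (\<nu> + 2 + y) * q" unfolding pq by (simp add: power2_eq_square algebra_simps)
  then have "y * p < y * ((\<nu> + 2 + y) * q)" using y by simp
  then have "y / (\<nu> + 2 + y) < y * q / p"
    using p y assms by (simp add: field_simps)
  moreover have "t / (t + 2 * (\<nu> + 2)) = y / (\<nu> + 2 + y)"
    using y assms by (simp add: field_simps)
  ultimately have "y * q / p > t / (t + 2 * (\<nu> + 2))" by simp
  moreover have "bessel_f \<nu> t = (y * q / p + 2 * (\<nu> + 1) / t) * bessel_g \<nu> t"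
    unfolding bessel_f_def bessel_g_def y_def[symmetric] f p_def[symmetric]
    using p y by (simp add: field_simps power2_eq_square)
  moreover have "bessel_g_deriv \<nu> t = (y * q / p + 1 / t) * bessel_g \<nu> t"
    unfolding bessel_g_deriv_def bessel_g_def y_def[symmetric] p_def[symmetric] q_def[symmetric]
    using p y by (simp add: field_simps power2_eq_square)
  ultimately show thesis by (rule that)
qed

section \<open>The bound below and above the threshold\<close>

lemma weighted_integral_less:
  assumes "\<nu> > -1/2" "0 \<le> \<gamma>" "x > 0"
  shows "integral {0..x} (\<lambda>t. exp (-\<gamma> * t) * bessel_f \<nu> t) < 2 * (\<nu> + 1) * bessel_g \<nu> x"
proof -
  have \<nu>: "\<nu> > -1" using assms by simp
  have "integral {0..x} (\<lambda>t. exp (-\<gamma> * t) * bessel_f \<nu> t)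
        < 2 * (\<nu> + 1) * bessel_g \<nu> x - 2 * (\<nu> + 1) * bessel_g \<nu> 0"
  proof (rule integral_less_increment[where G' = "\<lambda>t. 2 * (\<nu> + 1) * bessel_g_deriv \<nu> t"])
    show "continuous_on {0..x} (\<lambda>t. exp (-\<gamma> * t) * bessel_f \<nu> t)"
      by (intro continuous_intros continuous_on_bessel_f \<nu>)
    show "((\<lambda>t. 2 * (\<nu> + 1) * bessel_g \<nu> t) has_real_derivative 2 * (\<nu> + 1) * bessel_g_deriv \<nu> t) (at t)"
      for t by (intro DERIV_cmult DERIV_bessel_g \<nu>)
    fix t :: real assume t: "0 < t" "t < x"
    obtain r where r: "r > t / (t + 2 * (\<nu> + 2))"
        "bessel_f \<nu> t = (r + 2 * (\<nu> + 1) / t) * bessel_g \<nu> t"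
        "bessel_g_deriv \<nu> t = (r + 1 / t) * bessel_g \<nu> t"
      by (rule bessel_ratio[OF \<nu> t(1)])
    have g: "bessel_g \<nu> t > 0" by (rule bessel_g_pos[OF \<nu> t(1)])
    have "t / (t + 2 * (\<nu> + 2)) > 0" using t assms by (intro divide_pos_pos) auto
    then have rpos: "r > 0" using r(1) by simp
    have "exp (-\<gamma> * t) * bessel_f \<nu> t \<le> 1 * bessel_f \<nu> t"
      using \<nu> t assms by (intro mult_right_mono) (auto simp: bessel_f_def bessel_series_pos less_imp_le)
    also have "\<dots> < (r + 2 * (\<nu> + 1) / t) * bessel_g \<nu> t + (2 * \<nu> + 1) * r * bessel_g \<nu> t"
      using rpos g assms unfolding r(2) by simp
    also have "\<dots> = 2 * (\<nu> + 1) * bessel_g_deriv \<nu> t"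
      unfolding r(3) by (simp add: algebra_simps add_divide_distrib)
    finally show "exp (-\<gamma> * t) * bessel_f \<nu> t < 2 * (\<nu> + 1) * bessel_g_deriv \<nu> t" .
  qed fact
  then show ?thesis by (simp add: bessel_g_def)
qed

text \<open>The difference of the two sides increases with \<open>r\<close>, because \<open>M \<ge> 1\<close>, so it suffices to
  look at \<open>r = \<theta>\<close>. There the term \<open>M u\<close> can be discarded, and the left-hand side is largest at the
  upper end of the range of \<open>u\<close> (in the application \<open>u = 1/t\<close> with \<open>t \<ge> x\<^sub>0\<close>); the remaining inequality is \<open>(\<nu>+2)\<theta>\<^sup>2 \<le> (\<nu>+2)\<theta>\<close>.\<close>

lemma tail_constant_bound:
  fixes \<nu> \<gamma> \<theta> M r u :: real
  assumes "\<nu> > -1" "0 < \<gamma>" "\<gamma> < \<theta>" "\<theta> < 1"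
    and M: "M \<ge> (\<nu> + 1 + \<theta>) / ((\<nu> + 2) * \<theta> * (\<theta> - \<gamma>))"
    and r: "r \<ge> \<theta>" and u: "0 < u" "u \<le> (1 - \<theta>) / (2 * (\<nu> + 2) * \<theta>)"
  shows "r + 2 * (\<nu> + 1) * u < M * (r + u - \<gamma>)"
proof -
  have c: "(\<nu> + 2) * \<theta> > 0" using assms by simp
  have M1: "\<nu> + 1 + \<theta> \<le> M * (\<theta> - \<gamma>) * ((\<nu> + 2) * \<theta>)"
    using M assms c by (simp add: pos_divide_le_eq mult_ac)
  have "0 < 2 * (\<nu> + 2) * \<theta>" using assms by simp
  then have "u * (2 * (\<nu> + 2) * \<theta>) \<le> 1 - \<theta>" using u(2) by (simp only: pos_le_divide_eq)
  then have u1: "2 * u * ((\<nu> + 2) * \<theta>) \<le> 1 - \<theta>" by (simp only: mult_ac)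
  have th2: "\<theta> * \<theta> \<le> \<theta>" using assms mult_left_le[of \<theta> \<theta>] by simp
  have "(\<nu> + 2) * \<theta> \<le> \<nu> + 1 + \<theta>"
    using assms mult_left_le[of \<theta> "\<nu> + 1"] by (simp add: algebra_simps)
  with M1 have "1 * ((\<nu> + 2) * \<theta>) \<le> M * (\<theta> - \<gamma>) * ((\<nu> + 2) * \<theta>)" by simp
  then have M2: "1 \<le> M * (\<theta> - \<gamma>)" using c mult_right_le_imp_le by blast
  then have Mpos: "0 < M" using assms by (smt (verit) mult_nonpos_nonneg)
  have "M * (\<theta> - \<gamma>) \<le> M * 1" using Mpos assms by (intro mult_left_mono) auto
  then have M3: "M \<ge> 1" using M2 by simp
  have "(\<theta> + 2 * (\<nu> + 1) * u) * ((\<nu> + 2) * \<theta>)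
      = (\<nu> + 2) * (\<theta> * \<theta>) + (\<nu> + 1) * (2 * u * ((\<nu> + 2) * \<theta>))"
    by (simp add: algebra_simps)
  also have "\<dots> \<le> (\<nu> + 2) * \<theta> + (\<nu> + 1) * (1 - \<theta>)"
    using th2 u1 assms by (intro add_mono mult_left_mono) auto
  also have "\<dots> = \<nu> + 1 + \<theta>" by (simp add: algebra_simps)
  also note M1
  finally have "\<theta> + 2 * (\<nu> + 1) * u \<le> M * (\<theta> - \<gamma>)" using c mult_right_le_imp_le by blast
  moreover have "1 * (r - \<theta>) \<le> M * (r - \<theta>)" using M3 r by (intro mult_right_mono) auto
  ultimately have "(\<theta> + 2 * (\<nu> + 1) * u) + 1 * (r - \<theta>) \<le> M * (\<theta> - \<gamma>) + M * (r - \<theta>)"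
    by (rule add_mono)
  also have "\<dots> < M * (\<theta> - \<gamma>) + M * (r - \<theta>) + M * u" using Mpos u by simp
  also have "\<dots> = M * (r + u - \<gamma>)" by (simp add: algebra_simps)
  finally show ?thesis by simp
qed

lemma weighted_integral_tail_less:
  assumes "\<nu> > -1" "0 < \<gamma>" "\<gamma> < \<theta>" "\<theta> < 1"
    and M: "M \<ge> (\<nu> + 1 + \<theta>) / ((\<nu> + 2) * \<theta> * (\<theta> - \<gamma>))"
    and x0: "x\<^sub>0 = 2 * (\<nu> + 2) * \<theta> / (1 - \<theta>)" and "x\<^sub>0 < x"
  shows "integral {x\<^sub>0..x} (\<lambda>t. exp (-\<gamma> * t) * bessel_f \<nu> t)
         < M * exp (-\<gamma> * x) * bessel_g \<nu> x - M * exp (-\<gamma> * x\<^sub>0) * bessel_g \<nu> x\<^sub>0"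
proof (rule integral_less_increment
    [where G' = "\<lambda>t. M * exp (-\<gamma> * t) * (bessel_g_deriv \<nu> t - \<gamma> * bessel_g \<nu> t)"])
  show "continuous_on {x\<^sub>0..x} (\<lambda>t. exp (-\<gamma> * t) * bessel_f \<nu> t)"
    by (intro continuous_intros continuous_on_bessel_f assms)
  show "((\<lambda>t. M * exp (-\<gamma> * t) * bessel_g \<nu> t) has_real_derivative
          M * exp (-\<gamma> * t) * (bessel_g_deriv \<nu> t - \<gamma> * bessel_g \<nu> t)) (at t)" for t
    by (rule derivative_eq_intros DERIV_bessel_g assms refl)+ (simp add: algebra_simps)
  fix t assume t: "x\<^sub>0 < t" "t < x"
  have x0pos: "x\<^sub>0 > 0" using assms by simp
  then have t0: "t > 0" using t by simp
  obtain r where r: "r > t / (t + 2 * (\<nu> + 2))"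
      "bessel_f \<nu> t = (r + 2 * (\<nu> + 1) / t) * bessel_g \<nu> t"
      "bessel_g_deriv \<nu> t = (r + 1 / t) * bessel_g \<nu> t"
    by (rule bessel_ratio[OF assms(1) t0])
  have g: "bessel_g \<nu> t > 0" by (rule bessel_g_pos[OF assms(1) t0])
  have t1: "2 * (\<nu> + 2) * \<theta> < t * (1 - \<theta>)"
    using t(1) assms unfolding x0 by (simp add: pos_divide_less_eq)
  have "\<theta> \<le> t / (t + 2 * (\<nu> + 2))"
    using t1 t0 assms by (simp add: pos_le_divide_eq algebra_simps)
  then have r\<theta>: "r \<ge> \<theta>" using r(1) by simp
  have u: "1 / t \<le> (1 - \<theta>) / (2 * (\<nu> + 2) * \<theta>)"
    using t1 t0 assms by (simp add: pos_le_divide_eq pos_divide_le_eq mult.commute[of "1 - \<theta>"])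
  have "r + 2 * (\<nu> + 1) * (1 / t) < M * (r + 1 / t - \<gamma>)"
    using tail_constant_bound[OF assms(1-4) M r\<theta> _ u] t0 by simp
  then have "(exp (-\<gamma> * t) * bessel_g \<nu> t) * (r + 2 * (\<nu> + 1) * (1 / t))
           < (exp (-\<gamma> * t) * bessel_g \<nu> t) * (M * (r + 1 / t - \<gamma>))"
    using g by (intro mult_strict_left_mono) auto
  then show "exp (-\<gamma> * t) * bessel_f \<nu> t
      < M * exp (-\<gamma> * t) * (bessel_g_deriv \<nu> t - \<gamma> * bessel_g \<nu> t)"
    unfolding r(2,3) by (simp add: algebra_simps add_divide_distrib)
qed fact

lemma weighted_integral_bound:
  assumes "\<nu> > -1/2" "0 < \<gamma>" "\<gamma> < \<theta>" "\<theta> < 1" "x > 0"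
    and M1: "M \<ge> 2 * (\<nu> + 1) * exp (2 * \<gamma> * (\<nu> + 2) * \<theta> / (1 - \<theta>))"
    and M2: "M \<ge> (\<nu> + 1 + \<theta>) / ((\<nu> + 2) * \<theta> * (\<theta> - \<gamma>))"
  shows "integral {0..x} (\<lambda>t. exp (-\<gamma> * t) * bessel_f \<nu> t) < M * exp (-\<gamma> * x) * bessel_g \<nu> x"
proof -
  have \<nu>: "\<nu> > -1" using assms by simp
  let ?\<phi> = "\<lambda>t. exp (-\<gamma> * t) * bessel_f \<nu> t"
  define x\<^sub>0 where "x\<^sub>0 = 2 * (\<nu> + 2) * \<theta> / (1 - \<theta>)"
  have x0: "x\<^sub>0 > 0" unfolding x\<^sub>0_def using assms by simp
  have M1': "M \<ge> 2 * (\<nu> + 1) * exp (\<gamma> * x\<^sub>0)"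
    using M1 by (simp add: x\<^sub>0_def mult_ac)
  have small: "integral {0..y} ?\<phi> < M * exp (-\<gamma> * y) * bessel_g \<nu> y" if y: "0 < y" "y \<le> x\<^sub>0" for y
  proof -
    have "2 * (\<nu> + 1) = 2 * (\<nu> + 1) * exp (\<gamma> * y) * exp (-\<gamma> * y)"
      by (simp add: exp_minus)
    also have "\<dots> \<le> 2 * (\<nu> + 1) * exp (\<gamma> * x\<^sub>0) * exp (-\<gamma> * y)"
      using y assms by (intro mult_right_mono mult_left_mono) auto
    also have "\<dots> \<le> M * exp (-\<gamma> * y)"
      using M1' by (intro mult_right_mono) auto
    finally have "2 * (\<nu> + 1) * bessel_g \<nu> y \<le> M * exp (-\<gamma> * y) * bessel_g \<nu> y"
      using bessel_g_pos[OF \<nu> y(1)] by (intro mult_right_mono) auto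
    then show ?thesis
      using weighted_integral_less[OF assms(1) _ y(1), of \<gamma>] assms by linarith
  qed
  show ?thesis
  proof (cases "x \<le> x\<^sub>0")
    case True
    then show ?thesis using small assms by simp
  next
    case False
    then have "x\<^sub>0 < x" by simp
    have "?\<phi> integrable_on {0..x}"
      by (intro integrable_continuous_interval continuous_intros continuous_on_bessel_f \<nu>)
    then have "integral {0..x} ?\<phi> = integral {0..x\<^sub>0} ?\<phi> + integral {x\<^sub>0..x} ?\<phi>"
      using x0 \<open>x\<^sub>0 < x\<close> by (intro Henstock_Kurzweil_Integration.integral_combine[symmetric]) auto
    then show ?thesis
      using small[OF x0 order_refl]
        weighted_integral_tail_less[OF \<nu> assms(2-4) M2 x\<^sub>0_def \<open>x\<^sub>0 < x\<close>] by linarith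
  qed
qed

theorem corollary9p2:
  fixes \<nu> \<gamma> :: real
  assumes "\<nu> > -1/2" and "0 < \<gamma>" and "\<gamma> < 1"
  shows "(\<forall>\<theta>\<in>{\<gamma><..<1}. \<forall>x>0.
            integral {0..x} (\<lambda>t. exp (-\<gamma> * t) * (bessel_I \<nu> t / t powr \<nu>))
            < max (2 * (\<nu> + 1) * exp (2 * \<gamma> * (\<nu> + 2) * \<theta> / (1 - \<theta>)))
                  ((\<nu> + 1 + \<theta>) / ((\<nu> + 2) * \<theta> * (\<theta> - \<gamma>)))
              * exp (-\<gamma> * x) * (bessel_I (\<nu> + 1) x / x powr \<nu>))
       \<and> (\<exists>M::real. \<forall>x>0.
            integral {0..x} (\<lambda>t. exp (-\<gamma> * t) * (bessel_I \<nu> t / t powr \<nu>))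
            < M * exp (-\<gamma> * x) * (bessel_I (\<nu> + 1) x / x powr \<nu>))"
proof -
  have \<nu>: "\<nu> > -1" using assms by simp
  have bound: "integral {0..x} (\<lambda>t. exp (-\<gamma> * t) * (bessel_I \<nu> t / t powr \<nu>))
            < max (2 * (\<nu> + 1) * exp (2 * \<gamma> * (\<nu> + 2) * \<theta> / (1 - \<theta>)))
                  ((\<nu> + 1 + \<theta>) / ((\<nu> + 2) * \<theta> * (\<theta> - \<gamma>)))
              * exp (-\<gamma> * x) * (bessel_I (\<nu> + 1) x / x powr \<nu>)"
    if \<theta>: "\<gamma> < \<theta>" "\<theta> < 1" and x: "x > 0" for \<theta> x
  proof -
    \<comment> \<open>At \<open>t = 0\<close> the quotient takes the default value \<open>0\<close> instead of its limit, so the two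
      integrands agree only off a null set.\<close>
    have "integral {0..x} (\<lambda>t. exp (-\<gamma> * t) * (bessel_I \<nu> t / t powr \<nu>))
        = integral {0..x} (\<lambda>t. exp (-\<gamma> * t) * bessel_f \<nu> t)"
      using \<nu> by (intro integral_spike[of "{0}"]) (auto simp: bessel_I_div_powr)
    also have "\<dots> < max (2 * (\<nu> + 1) * exp (2 * \<gamma> * (\<nu> + 2) * \<theta> / (1 - \<theta>)))
                  ((\<nu> + 1 + \<theta>) / ((\<nu> + 2) * \<theta> * (\<theta> - \<gamma>))) * exp (-\<gamma> * x) * bessel_g \<nu> x"
      using weighted_integral_bound[OF assms(1,2) \<theta> x max.cobounded1 max.cobounded2] .
    finally show ?thesis by (simp only: bessel_I_Suc_div_powr[OF \<nu> x])
  qed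
  have "\<gamma> < (1 + \<gamma>) / 2" "(1 + \<gamma>) / 2 < 1" using assms by auto
  then show ?thesis using bound by (meson greaterThanLessThan_iff)
qed

end
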